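(* Let $a,b\in\mathbb{R}$, and let $\{P_n(z)\}_{n=0}^{\infty}$ be the sequence of polynomials in $z$ generated by $$\sum_{n=0}^{\infty}P_{n}(z)t^{n}=\frac{1}{(t+1)\left((az+b)t^{2}+zt+1\right)}.$$ Then all the zeros (in $\mathbb{C}$) of all the polynomials $P_n(z)$, $n\ge 0$, are real if and only if $b\ge 1+2|a|$. Moreover, if $b\ge 1+2|a|$, then for every $n$ the zeros of $P_n(z)$ lie on the open interval $$I=\left(2a-2\sqrt{a^{2}+b},\;2a+2\sqrt{a^{2}+b}\right),$$ and they are dense in $I$ as $n\to\infty$, i.e. every nonempty open subinterval of $I$ contains a zero of $P_n(z)$ for all sufficiently large $n$.
   Context: The right-hand side of the generating function is expanded as a formal power series in $t$ whose coefficients are polynomials in $z$ with real coefficients; $P_n(z)$ is the coefficient of $t^n$. *)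

theory Defs
  imports "HOL-Analysis.Analysis" "HOL-Computational_Algebra.Computational_Algebra"
begin

(* A formal power series in t with coefficients in R[z]: "fps_X" is t and the polynomial
   "[:0, 1:]" is z, so that "[:b, a:]" is a z + b. *)
definition gen_denom :: "real \<Rightarrow> real \<Rightarrow> real poly fps" where
  "gen_denom a b =
     (fps_X + 1) * (fps_const [:b, a:] * fps_X ^ 2 + fps_const [:0, 1:] * fps_X + 1)"

(* The ring of real polynomials has no total "inverse" operation in the library, so the equation
   "sum of P n * t ^ n = 1 / gen_denom a b" is stated by saying that the left-hand side is the
   multiplicative inverse of the denominator in R[z][[t]]. *)
definition generated_by :: "real \<Rightarrow> real \<Rightarrow> (nat \<Rightarrow> real poly) \<Rightarrow> bool" where
  "generated_by a b P \<longleftrightarrow> Abs_fps P * gen_denom a b = 1"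

lemma generated_by_ex1: "\<exists>!P. generated_by a b P"
proof -
  let ?D = "gen_denom a b"
  have "?D $ 0 = 1"
    by (simp add: gen_denom_def)
  then have inv: "?D * fps_right_inverse ?D 1 = 1"
    by (intro fps_right_inverse) simp
  show ?thesis
  proof (rule ex1I)
    show "generated_by a b (\<lambda>n. fps_right_inverse ?D 1 $ n)"
      unfolding generated_by_def fps_nth_Abs_fps using inv by (subst mult.commute)
  next
    fix P assume "generated_by a b P"
    then have PD: "Abs_fps P * ?D = 1"
      by (simp add: generated_by_def)
    have "Abs_fps P = Abs_fps P * (?D * fps_right_inverse ?D 1)"
      by (simp only: inv mult_1_right)
    also have "\<dots> = fps_right_inverse ?D 1"
      by (simp only: mult.assoc [symmetric] PD mult_1_left)
    finally have "Abs_fps P = fps_right_inverse ?D 1" .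
    then have "Abs_fps P $ n = fps_right_inverse ?D 1 $ n" for n
      by (rule arg_cong)
    then show "P = (\<lambda>n. fps_right_inverse ?D 1 $ n)"
      by (intro ext) (simp only: fps_nth_Abs_fps)
  qed
qed

definition zeros :: "real poly \<Rightarrow> complex set" where
  "zeros p = {z. poly (map_poly complex_of_real p) z = 0}"

definition zero_interval :: "real \<Rightarrow> real \<Rightarrow> real set" where
  "zero_interval a b = {2 * a - 2 * sqrt (a\<^sup>2 + b) <..< 2 * a + 2 * sqrt (a\<^sup>2 + b)}"

end

theory Submission
  imports Defs
begin

text \<open>For fixed \<open>z\<close>, the behaviour of \<open>P\<^sub>n(z)\<close> is governed by the three poles of the generating function:
  \<open>t = -1\<close> and the two zeros of \<open>(a z + b) t\<^sup>2 + z t + 1\<close>.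

  If \<open>b \<ge> 1 + 2 |a|\<close>, the two zeros of the quadratic are complex conjugates \<open>e\<^sup>\<plusminus>\<^sup>i\<^sup>\<theta> / r\<close> for \<open>z\<close> in the
  interval \<open>I\<close>, where \<open>r = sqrt (a z + b)\<close> and \<open>z = - 2 r cos \<theta>\<close>. This is a parametrisation of \<open>I\<close> by
  \<open>\<theta> \<in> (0, \<pi>)\<close>, and the size of \<open>b\<close> forces \<open>r \<ge> 1\<close>: the conjugate pair is at least as close to \<open>0\<close> as
  \<open>-1\<close>. Hence the oscillating contribution of the pair to \<open>P\<^sub>n(z)\<close> beats the contribution of the pole
  \<open>-1\<close> at the \<open>n + 1\<close> angles \<open>(2 k + 1) \<pi> / (2 n + 3)\<close>, where the pair contributes with sign
  \<open>(-1)\<^sup>k\<close> (lemma \<open>generated_by_sign\<close>). As \<open>P\<^sub>n\<close> has degree at most \<open>n\<close>, the \<open>n\<close> sign changes account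
  for all its zeros, and the equidistribution of the angles gives density.

  If \<open>b < 1 + 2 |a|\<close>, there is a real point \<open>z\<close> at which the dominant poles tie: two of them
  are equal to or opposite to each other, with moduli less than or equal to that of every other pole.
  Under the scaling \<open>z + s / n\<close>, \<open>P\<^sub>n\<close> then looks for even \<open>n\<close> like a sum of two real exponentials
  \<open>B e\<^sup>\<mu>\<^sup>s + C e\<^sup>\<nu>\<^sup>s\<close> with \<open>B, C > 0\<close> and \<open>\<mu> \<noteq> \<nu>\<close>, or like their confluent form \<open>(e\<^sup>\<mu>\<^sup>s - 1) / s\<close>. Both have
  only non-real zeros. What is used is the real shadow of this fact: both functions are
  strictly log-convex at \<open>s = 0\<close>, whereas a polynomial \<open>p\<close> with only real zeros satisfies Laguerre's
  inequality \<open>p p'' \<le> p'\<^sup>2\<close> on the real line (lemma \<open>laguerre_inequality\<close>). So it suffices to know the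
  leading growth in \<open>n\<close> of \<open>P\<^sub>n(z)\<close>, \<open>P\<^sub>n'(z)\<close> and \<open>P\<^sub>n''(z)\<close>, and this is read off from their
  rational generating functions. The point \<open>z\<close> is chosen as follows.

    \<^item> \<open>-1 < b < 1 + 2 a\<close>, \<open>a \<ge> 0\<close>: the quadratic has the zero \<open>1\<close>, opposite to \<open>-1\<close>.
    \<^item> \<open>-1 < b < 1 - 2 a\<close>, \<open>a < 0\<close>: the quadratic has the zero \<open>-1\<close>, which becomes a double pole.
    \<^item> \<open>b < -1\<close>: at \<open>z = 0\<close> the quadratic has opposite zeros of modulus less than \<open>1\<close>.
    \<^item> \<open>b = -1\<close>: at \<open>z = 0\<close> the zeros of the quadratic are \<open>1\<close> and \<open>-1\<close>, so that \<open>-1\<close> is again a double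
      pole. The rates \<open>\<mu>\<close> degenerate for \<open>a = 1\<close>, and there \<open>P\<^sub>2 = z\<^sup>2 + 2\<close>.\<close>

section \<open>Real-rooted polynomials\<close>

lemma poly_map_poly_of_real:
  "poly (map_poly complex_of_real p) (complex_of_real x) = complex_of_real (poly p x)"
  by (induction p) (simp_all add: map_poly_pCons)

lemma map_poly_of_real_mult:
  "map_poly complex_of_real (p * q) = map_poly complex_of_real p * map_poly complex_of_real q"
  by (rule poly_eqI) (simp add: coeff_map_poly coeff_mult)

lemma of_real_mem_zeros_iff: "complex_of_real x \<in> zeros p \<longleftrightarrow> poly p x = 0"
  by (simp add: zeros_def poly_map_poly_of_real)

lemma degree_map_poly_of_real: "degree (map_poly complex_of_real p) = degree p"
  by (rule degree_map_poly) simp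

text \<open>The logarithmic derivative of \<open>p = c \<Prod>(x - r\<^sub>i)\<close> is \<open>\<Sum>1 / (x - r\<^sub>i)\<close>, which is decreasing between
  the zeros \<open>r\<^sub>i\<close>. Splitting off one root at a time avoids dividing by \<open>p\<close>, so that \<open>x\<close> may be a zero.\<close>

lemma laguerre_inequality:
  assumes "zeros p \<subseteq> \<real>"
  shows "poly p x * poly (pderiv (pderiv p)) x \<le> (poly (pderiv p) x)\<^sup>2"
  using assms
proof (induction "degree p" arbitrary: p rule: less_induct)
  case less
  show ?case
  proof (cases "degree p = 0")
    case True
    then show ?thesis
      by (metis degree_eq_zeroE mult_zero_right order_refl pderiv_0 pderiv_singleton poly_0 power2_eq_square)
  next
    case False
    then have "\<not> constant (poly (map_poly complex_of_real p))"
      by (simp add: constant_degree degree_map_poly_of_real)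
    then obtain z where z: "z \<in> zeros p"
      using fundamental_theorem_of_algebra unfolding zeros_def by blast
    then obtain r where r: "z = complex_of_real r"
      using less.prems by (blast elim: Reals_cases)
    with z have "poly p r = 0"
      by (simp add: of_real_mem_zeros_iff)
    then obtain g where p: "p = [:- r, 1:] * g"
      by (auto simp: poly_eq_0_iff_dvd)
    have "zeros g \<subseteq> zeros p"
      unfolding p zeros_def map_poly_of_real_mult by auto
    moreover have "degree g < degree p"
      using False unfolding p by (subst degree_mult_eq) auto
    ultimately have IH: "poly g x * poly (pderiv (pderiv g)) x \<le> (poly (pderiv g) x)\<^sup>2"
      using less by blast
    have dp: "pderiv p = [:- r, 1:] * pderiv g + g"
      unfolding p by (subst pderiv_mult) (simp add: pderiv_pCons)
    have ddp: "pderiv (pderiv p) = [:- r, 1:] * pderiv (pderiv g) + 2 * pderiv g"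
      unfolding dp pderiv_add by (subst pderiv_mult) (simp add: pderiv_pCons)
    have "(poly (pderiv p) x)\<^sup>2 - poly p x * poly (pderiv (pderiv p)) x
        = (poly g x)\<^sup>2 + (x - r)\<^sup>2 * ((poly (pderiv g) x)\<^sup>2 - poly g x * poly (pderiv (pderiv g)) x)"
      unfolding ddp unfolding dp unfolding p by (simp add: algebra_simps power2_eq_square)
    also have "\<dots> \<ge> 0"
      using IH by (intro add_nonneg_nonneg mult_nonneg_nonneg) auto
    finally show ?thesis by simp
  qed
qed


text \<open>The intermediate value theorem gives a zero in each of the \<open>n\<close> gaps, and the degree leaves no room
  for a further complex zero.\<close>

lemma zeros_subset_of_alternating_signs:
  fixes p :: "real poly" and y :: "nat \<Rightarrow> real"
  assumes deg: "degree p \<le> n"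
    and y: "\<And>i j. i < j \<Longrightarrow> j \<le> n \<Longrightarrow> y i < y j"
    and sign: "\<And>k. k \<le> n \<Longrightarrow> (-1) ^ k * poly p (y k) > 0"
  shows "zeros p \<subseteq> complex_of_real ` {y 0<..<y n}"
proof -
  have "\<exists>x. y k < x \<and> x < y (Suc k) \<and> poly p x = 0" if "k < n" for k
  proof -
    have "y k < y (Suc k)"
      using y that by simp
    moreover have "poly p (y k) * poly p (y (Suc k)) < 0"
      using sign[of k] sign[of "Suc k"] that by (cases "even k") (simp_all add: mult_less_0_iff)
    ultimately show ?thesis
      using poly_IVT by blast
  qed
  then obtain g where g: "\<And>k. k < n \<Longrightarrow> y k < g k" "\<And>k. k < n \<Longrightarrow> g k < y (Suc k)"
    "\<And>k. k < n \<Longrightarrow> poly p (g k) = 0"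
    by metis
  have y_mono: "y i \<le> y j" if "i \<le> j" "j \<le> n" for i j
    using y[of i j] that by (cases "i = j") auto
  have "inj_on g {..<n}"
  proof (rule linorder_inj_onI')
    fix i j assume "i \<in> {..<n}" "j \<in> {..<n}" "i < j"
    then show "g i \<noteq> g j"
      using g(2)[of i] g(1)[of j] y_mono[of "Suc i" j] by auto
  qed
  then have card: "card (complex_of_real ` g ` {..<n}) = n"
    by (simp add: card_image inj_on_def)
  have "p \<noteq> 0"
    using sign[of 0] by auto
  then have nz: "map_poly complex_of_real p \<noteq> 0"
    by (simp add: map_poly_eq_0_iff)
  have "finite (zeros p)"
    unfolding zeros_def using nz by (rule poly_roots_finite)
  moreover have "card (zeros p) \<le> n"
    unfolding zeros_def using card_poly_roots_bound[OF nz] deg by (simp add: degree_map_poly_of_real)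
  moreover have "complex_of_real ` g ` {..<n} \<subseteq> zeros p"
    using g(3) by (auto simp: of_real_mem_zeros_iff)
  ultimately have "zeros p = complex_of_real ` g ` {..<n}"
    using card by (metis card_seteq)
  moreover have "g k \<in> {y 0<..<y n}" if "k < n" for k
    using g(1,2)[OF that] y_mono[of 0 k] y_mono[of "Suc k" n] that by auto
  ultimately show ?thesis
    by auto
qed

section \<open>The recurrence behind the generating function\<close>

text \<open>Multiplying the generating function by \<open>1 + t\<close> leaves the series of the \<open>H n\<close>, the inverse of the
  quadratic factor; this replaces a four-term recurrence for \<open>P\<close> by two shorter ones.\<close>

lemma generated_by_recurrence:
  assumes "generated_by a b P"
  obtains H :: "nat \<Rightarrow> real poly" where
    "H 0 = 1" "H 1 = - [:0, 1:]" "\<And>n. H (n + 2) = - [:0, 1:] * H (n + 1) - [:b, a:] * H n"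
    "P 0 = 1" "\<And>n. P (Suc n) = H (Suc n) - P n"
proof -
  define F where "F = (1 + fps_X) * Abs_fps P"
  have "F * (fps_const [:b, a:] * fps_X ^ 2 + fps_const [:0, 1:] * fps_X + 1) = 1"
    using assms by (simp add: generated_by_def gen_denom_def F_def ac_simps)
  then have "fps_const [:b, a:] * (F * fps_X ^ 2) + fps_const [:0, 1:] * (F * fps_X) + F = 1"
    by (simp add: algebra_simps)
  then have eq: "(fps_const [:b, a:] * (F * fps_X ^ 2) + fps_const [:0, 1:] * (F * fps_X) + F) $ n = 1 $ n" for n
    by (rule arg_cong)
  have F: "F $ n = (if n = 0 then P n else P n + P (n - 1))" for n
    unfolding F_def by (subst fps_mult_fps_X_plus_1_nth) simp
  show ?thesis
  proof (rule that[of "\<lambda>n. F $ n"])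
    show F0: "F $ 0 = 1"
      using eq[of 0] by (simp add: fps_X_power_mult_right_nth)
    show "F $ 1 = - [:0, 1:]"
    proof -
      have "F $ 1 + [:0, 1:] = 0"
        using eq[of 1] F0 by (simp add: fps_X_power_mult_right_nth add.commute)
      then show ?thesis
        by (simp only: eq_neg_iff_add_eq_0)
    qed
    show "F $ (n + 2) = - [:0, 1:] * F $ (n + 1) - [:b, a:] * F $ n" for n
    proof -
      have "[:b, a:] * F $ n + [:0, 1:] * F $ (n + 1) + F $ (n + 2) = 0"
        using eq[of "n + 2"] by (simp add: fps_X_power_mult_right_nth)
      moreover have "v = - y * u - x" if "x + y * u + v = 0" for x y u v :: "real poly"
        using that by algebra
      ultimately show ?thesis by blast
    qed
    show "P 0 = 1"
      using F[of 0] F0 by simp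
    show "P (Suc n) = F $ Suc n - P n" for n
      using F[of "Suc n"] by simp
  qed
qed

lemma degree_generated_by:
  assumes "generated_by a b P"
  shows "degree (P n) \<le> n"
proof -
  obtain H :: "nat \<Rightarrow> real poly" where H: "H 0 = 1" "H 1 = - [:0, 1:]"
    "\<And>n. H (n + 2) = - [:0, 1:] * H (n + 1) - [:b, a:] * H n"
    and P: "P 0 = 1" "\<And>n. P (Suc n) = H (Suc n) - P n"
    using generated_by_recurrence[OF assms] by blast
  have H_deg: "degree (H n) \<le> n" for n
  proof (induction n rule: less_induct)
    case (less n)
    consider "n = 0" | "n = 1" | m where "n = m + 2"
      by (metis One_nat_def Suc_1 add_2_eq_Suc' not0_implies_Suc)
    then show ?case
    proof cases
      case 3
      have "degree (- [:0, 1:] * H (m + 1)) \<le> degree (- [:0, 1 :: real:]) + degree (H (m + 1))"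
        "degree ([:b, a:] * H m) \<le> degree [:b, a:] + degree (H m)"
        by (rule degree_mult_le)+
      moreover have "degree [:b, a:] \<le> 1" "degree (H (m + 1)) \<le> m + 1" "degree (H m) \<le> m"
        using less.IH[of "m + 1"] less.IH[of m] 3 by (simp_all add: degree_pCons_le)
      ultimately show ?thesis
        unfolding 3 H(3) by (intro degree_diff_le) auto
    qed (auto simp: H(1,2) simp del: One_nat_def)
  qed
  show ?thesis
  proof (induction n)
    case (Suc n)
    then show ?case
      using H_deg[of "Suc n"] unfolding P(2) by (intro degree_diff_le) auto
  qed (simp add: P)
qed

text \<open>With \<open>z = - 2 r cos \<theta>\<close> and \<open>a z + b = r\<^sup>2\<close> the quadratic factor is \<open>(1 - r e\<^sup>i\<^sup>\<theta> t) (1 - r e\<^sup>-\<^sup>i\<^sup>\<theta> t)\<close>, and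
  the formula is the partial fraction expansion of the generating function. The factor
  \<open>1 - z + r\<^sup>2\<close> is the value of the quadratic at the remaining pole \<open>t = -1\<close>.\<close>

lemma generated_by_trig_form:
  fixes r \<theta> :: real
  assumes gen: "generated_by a b P"
    and z: "z = - 2 * r * cos \<theta>" and c: "a * z + b = r\<^sup>2"
  shows "poly (P n) z * (1 - z + r\<^sup>2) * sin \<theta> =
    (-1) ^ n * sin \<theta> + r ^ Suc n * (sin (real (n + 2) * \<theta>) + r * sin (real (n + 1) * \<theta>))"
proof -
  obtain H :: "nat \<Rightarrow> real poly" where H: "H 0 = 1" "H 1 = - [:0, 1:]"
    "\<And>n. H (n + 2) = - [:0, 1:] * H (n + 1) - [:b, a:] * H n"
    and P: "P 0 = 1" "\<And>n. P (Suc n) = H (Suc n) - P n"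
    using generated_by_recurrence[OF gen] by blast
  have three_term: "sin (real (n + 2) * \<theta>) = 2 * cos \<theta> * sin (real (n + 1) * \<theta>) - sin (real n * \<theta>)" for n
  proof -
    have "real (n + 2) * \<theta> = real (n + 1) * \<theta> + \<theta>" "real n * \<theta> = real (n + 1) * \<theta> - \<theta>"
      by (simp_all add: algebra_simps)
    then show ?thesis
      by (simp only: sin_add sin_diff) simp
  qed
  have c': "poly [:b, a:] z = r\<^sup>2"
    using c by (simp add: mult.commute add.commute)
  \<comment> \<open>The coefficients of the inverse quadratic are Chebyshev polynomials of the second kind.\<close>
  have Hn: "poly (H n) z * sin \<theta> = r ^ n * sin (real (n + 1) * \<theta>)" for n
  proof (induction n rule: less_induct)
    case (less n)
    consider "n = 0" | "n = 1" | m where "n = m + 2"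
      by (metis One_nat_def Suc_1 add_2_eq_Suc' not0_implies_Suc)
    then show ?case
    proof cases
      case 1
      then show ?thesis by (simp add: H)
    next
      case 2
      then show ?thesis using three_term[of 0] by (simp add: H(2) z del: One_nat_def)
    next
      case 3
      have "poly (H n) z * sin \<theta> = - z * (poly (H (m + 1)) z * sin \<theta>) - r\<^sup>2 * (poly (H m) z * sin \<theta>)"
        unfolding 3 H(3) poly_diff poly_mult c' by (simp add: algebra_simps)
      also have "\<dots> = - z * (r ^ (m + 1) * sin (real (m + 2) * \<theta>)) - r\<^sup>2 * (r ^ m * sin (real (m + 1) * \<theta>))"
        using less.IH[of "m + 1"] less.IH[of m] 3 by (simp add: algebra_simps)
      also have "\<dots> = r ^ (m + 2) * (2 * cos \<theta> * sin (real (m + 2) * \<theta>) - sin (real (m + 1) * \<theta>))"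
        by (simp add: z algebra_simps power2_eq_square)
      also have "\<dots> = r ^ n * sin (real (n + 1) * \<theta>)"
        using three_term[of "m + 1"] 3 by (simp add: add.commute)
      finally show ?thesis .
    qed
  qed
  define Q where "Q = 1 - z + r\<^sup>2"
  have Q: "Q = 1 + 2 * r * cos \<theta> + r\<^sup>2"
    by (simp add: Q_def z)
  have "poly (P n) z * sin \<theta> * Q =
    (-1) ^ n * sin \<theta> + r ^ Suc n * (sin (real (n + 2) * \<theta>) + r * sin (real (n + 1) * \<theta>))"
  proof (induction n)
    case 0
    then show ?case
      using three_term[of 0] by (simp add: P Q algebra_simps power2_eq_square)
  next
    case (Suc n)
    define s where "s = (\<lambda>k. sin (real (n + k) * \<theta>))"
    have s3: "s 3 = 2 * cos \<theta> * s 2 - s 1"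
      using three_term[of "n + 1"] by (simp add: s_def add.commute add.left_commute)
    have "poly (P (Suc n)) z * sin \<theta> * Q
        = (poly (H (Suc n)) z * sin \<theta>) * Q - poly (P n) z * sin \<theta> * Q"
      by (simp add: P(2) algebra_simps)
    also have "\<dots> = r ^ Suc n * s 2 * Q - ((-1) ^ n * sin \<theta> + r ^ Suc n * (s 2 + r * s 1))"
      unfolding Suc Hn by (simp add: s_def add.commute)
    also have "\<dots> = (-1) ^ Suc n * sin \<theta> + r ^ Suc (Suc n) * (s 3 + r * s 2)"
      unfolding Q s3 by (simp add: algebra_simps power2_eq_square)
    finally have "poly (P (Suc n)) z * sin \<theta> * Q = (-1) ^ Suc n * sin \<theta> + r ^ Suc (Suc n) * (s 3 + r * s 2)" .
    moreover have "Suc n + 2 = n + 3" "Suc n + 1 = n + 2"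
      by simp_all
    ultimately show ?case
      by (simp only: s_def)
  qed
  then show ?thesis
    by (simp add: Q_def ac_simps)
qed

section \<open>Zeros in the interval when b is large\<close>

text \<open>The point \<open>z = equimod_point a b (cos \<theta>)\<close> is where the quadratic factor has the zeros \<open>e\<^sup>\<plusminus>\<^sup>i\<^sup>\<theta> / r\<close> with
  \<open>r = equimod_radius a b (cos \<theta>)\<close>. The formulas result from solving \<open>z\<^sup>2 = 4 x\<^sup>2 (a z + b)\<close> for \<open>z\<close>, with
  the sign of the square root for which \<open>z = - 2 r x\<close> and \<open>r > 0\<close>.\<close>

definition equimod_radius :: "real \<Rightarrow> real \<Rightarrow> real \<Rightarrow> real" where
  "equimod_radius a b x = sqrt (a\<^sup>2 * x\<^sup>2 + b) - a * x"

definition equimod_point :: "real \<Rightarrow> real \<Rightarrow> real \<Rightarrow> real" where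
  "equimod_point a b x = - 2 * equimod_radius a b x * x"

context
  fixes a b :: real
  assumes b_pos: "b > 0"
begin

lemma radicand_pos: "a\<^sup>2 * x\<^sup>2 + b > 0"
  using b_pos by (intro add_nonneg_pos) auto

lemma equimod_radius_pos: "equimod_radius a b x > 0"
proof -
  have "\<bar>a * x\<bar> = sqrt (a\<^sup>2 * x\<^sup>2)"
    by (simp add: real_sqrt_mult abs_mult)
  also have "\<dots> < sqrt (a\<^sup>2 * x\<^sup>2 + b)"
    using b_pos by simp
  finally show ?thesis
    by (simp add: equimod_radius_def)
qed

lemma equimod_point_eq: "a * equimod_point a b x + b = (equimod_radius a b x)\<^sup>2"
proof -
  have "(sqrt (a\<^sup>2 * x\<^sup>2 + b))\<^sup>2 = a\<^sup>2 * x\<^sup>2 + b"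
    using radicand_pos[of x] by simp
  then show ?thesis
    by (simp add: equimod_point_def equimod_radius_def algebra_simps power2_eq_square)
qed

lemma has_derivative_equimod_point: "\<exists>D. (equimod_point a b has_real_derivative D) (at x) \<and> D < 0"
proof -
  define s where "s = sqrt (a\<^sup>2 * x\<^sup>2 + b)"
  define r where "r = equimod_radius a b x"
  have s: "s > 0" "s = r + a * x"
    using radicand_pos[of x] by (simp_all add: s_def r_def equimod_radius_def)
  have "(equimod_radius a b has_real_derivative a\<^sup>2 * x / s - a) (at x)"
    unfolding equimod_radius_def[abs_def] s_def using radicand_pos[of x]
    by (auto intro!: derivative_eq_intros simp: field_simps)
  then have "(equimod_point a b has_real_derivative - 2 * ((a\<^sup>2 * x / s - a) * x + r)) (at x)"
    unfolding equimod_point_def[abs_def] r_def by (auto intro!: derivative_eq_intros simp: algebra_simps)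
  moreover have "(a\<^sup>2 * x / s - a) * x + r = r\<^sup>2 / s"
    using s(1) by (simp add: field_simps) (simp add: s(2) algebra_simps power2_eq_square)
  moreover have "r\<^sup>2 / s > 0"
    using s(1) equimod_radius_pos[of x] by (simp add: r_def)
  ultimately show ?thesis
    by (metis mult_neg_pos neg_less_0_iff_less zero_less_numeral)
qed

lemma equimod_point_strict_antimono: "x < y \<Longrightarrow> equimod_point a b y < equimod_point a b x"
  by (erule DERIV_neg_imp_decreasing) (rule has_derivative_equimod_point)

lemma zero_interval_equimod_point: "zero_interval a b = {equimod_point a b 1<..<equimod_point a b (- 1)}"
  by (simp add: zero_interval_def equimod_point_def equimod_radius_def algebra_simps)

lemma zero_interval_equimod_pointE:
  assumes "v \<in> zero_interval a b"
  obtains x where "- 1 < x" "x < 1" "equimod_point a b x = v"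
proof -
  have "isCont (equimod_point a b) x" for x
    using has_derivative_equimod_point[of x] by (blast intro: DERIV_isCont)
  then obtain x where x: "- 1 \<le> x" "x \<le> 1" "equimod_point a b x = v"
    using IVT2[of "equimod_point a b" 1 v "- 1"] assms by (auto simp: zero_interval_equimod_point)
  moreover have "x \<noteq> 1" "x \<noteq> - 1"
    using x(3) assms by (auto simp: zero_interval_equimod_point)
  ultimately show ?thesis
    using that by force
qed

end

text \<open>If \<open>r < 1\<close>, then \<open>|z| = 2 r |x| \<le> 2\<close>, hence \<open>r\<^sup>2 = a z + b \<ge> b - 2 |a| \<ge> 1\<close>.\<close>

lemma equimod_radius_ge_1:
  assumes b: "b \<ge> 1 + 2 * \<bar>a\<bar>" and x: "\<bar>x\<bar> \<le> 1"
  shows "equimod_radius a b x \<ge> 1"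
proof (rule ccontr)
  assume "\<not> ?thesis"
  then have r: "equimod_radius a b x < 1" by simp
  have bp: "b > 0" using b by linarith
  have rp: "equimod_radius a b x > 0"
    by (rule equimod_radius_pos[OF bp])
  have "\<bar>equimod_point a b x\<bar> = 2 * (equimod_radius a b x * \<bar>x\<bar>)"
    using rp by (simp add: equimod_point_def abs_mult)
  also have "\<dots> \<le> 2 * (1 * 1)"
    using rp r x by (intro mult_left_mono mult_mono) auto
  finally have "\<bar>a * equimod_point a b x\<bar> \<le> \<bar>a\<bar> * 2"
    by (simp add: abs_mult mult_left_mono)
  then have "(equimod_radius a b x)\<^sup>2 \<ge> 1"
    unfolding equimod_point_eq[OF bp, symmetric] using b by linarith
  then show False
    using r rp by (metis abs_of_pos abs_square_less_1 not_le)
qed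

text \<open>At these angles \<open>sin ((n + 2) \<theta>)\<close> and \<open>sin ((n + 1) \<theta>)\<close> agree, both being \<open>(-1)\<^sup>k cos (\<theta> / 2)\<close>: the
  odd multiples of \<open>\<pi> / 2\<close> are attained by the mean \<open>(n + 3/2) \<theta>\<close> of the two arguments. This makes the
  sign of the oscillating part of \<open>P n\<close> independent of \<open>r\<close>.\<close>

definition sample_angle :: "nat \<Rightarrow> nat \<Rightarrow> real" where
  "sample_angle n k = real (2 * k + 1) * pi / real (2 * n + 3)"

lemma sample_angle_bounds: "k \<le> n \<Longrightarrow> 0 < sample_angle n k" "k \<le> n \<Longrightarrow> sample_angle n k < pi"
proof -
  show "0 < sample_angle n k"
    by (simp add: sample_angle_def)
  assume "k \<le> n"
  then have "real (2 * k + 1) * pi < real (2 * n + 3) * pi"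
    by (intro mult_strict_right_mono) auto
  then show "sample_angle n k < pi"
    by (simp add: sample_angle_def divide_less_eq mult.commute)
qed

lemma sin_sample_angle:
  "sin (real (n + 2) * sample_angle n k) = (-1) ^ k * cos (sample_angle n k / 2)"
  "sin (real (n + 1) * sample_angle n k) = (-1) ^ k * cos (sample_angle n k / 2)"
proof -
  define h where "h = real k * pi + pi / 2"
  have h: "real (2 * n + 3) * sample_angle n k = 2 * h"
    by (simp add: sample_angle_def h_def field_simps)
  have sc: "sin h = (-1) ^ k" "cos h = 0"
    by (simp_all add: h_def sin_add cos_add cos_npi)
  have "real (n + 2) * sample_angle n k = h + sample_angle n k / 2" "real (n + 1) * sample_angle n k = h - sample_angle n k / 2"
    using h by (simp_all add: algebra_simps)
  then show "sin (real (n + 2) * sample_angle n k) = (-1) ^ k * cos (sample_angle n k / 2)"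
    "sin (real (n + 1) * sample_angle n k) = (-1) ^ k * cos (sample_angle n k / 2)"
    by (simp_all add: sin_add sin_diff sc del: of_nat_add)
qed

text \<open>In the trigonometric form the oscillating part has absolute value
  \<open>r\<^sup>n\<^sup>+\<^sup>1 (1 + r) cos (\<theta> / 2) \<ge> 2 cos (\<theta> / 2)\<close> because \<open>r \<ge> 1\<close>, and this exceeds the other summand
  \<open>sin \<theta> = 2 sin (\<theta> / 2) cos (\<theta> / 2)\<close>.\<close>

lemma generated_by_sign:
  assumes gen: "generated_by a b P" and b: "b \<ge> 1 + 2 * \<bar>a\<bar>" and k: "k \<le> n"
  shows "(-1) ^ k * poly (P n) (equimod_point a b (cos (sample_angle n k))) > 0"
proof -
  define t where "t = sample_angle n k"
  define r where "r = equimod_radius a b (cos t)"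
  define z where "z = equimod_point a b (cos t)"
  have bp: "b > 0" using b by linarith
  have t: "0 < t" "t < pi"
    using sample_angle_bounds[OF k] by (simp_all add: t_def)
  have r: "r \<ge> 1"
    unfolding r_def using b by (rule equimod_radius_ge_1) simp
  have z: "z = - 2 * r * cos t" and c: "a * z + b = r\<^sup>2"
    using equimod_point_eq[OF bp] by (simp_all add: z_def r_def equimod_point_def)
  have sin: "sin t > 0"
    using t by (rule sin_gt_zero)
  have cos_half: "cos (t / 2) > 0"
    using t by (intro cos_gt_zero) auto
  have Q: "1 - z + r\<^sup>2 > 0"
  proof -
    \<comment> \<open>This factor is \<open>|1 + r e\<^sup>i\<^sup>\<theta>|\<^sup>2\<close>.\<close>
    have "cos t > - 1"
      using cos_monotone_0_pi[of t pi] t by simp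
    then have "r * cos t > r * - 1"
      using r by (intro mult_strict_left_mono) auto
    moreover have "1 - z + r\<^sup>2 = (1 - r)\<^sup>2 + 2 * (r * cos t + r)"
      by (simp add: z power2_eq_square algebra_simps)
    ultimately show ?thesis
      by (simp add: add_nonneg_pos)
  qed
  have "(-1) ^ k * (poly (P n) z * (1 - z + r\<^sup>2) * sin t) =
      (-1) ^ (n + k) * sin t + r ^ Suc n * ((1 + r) * cos (t / 2))"
    unfolding generated_by_trig_form[OF gen z c] sin_sample_angle[of n k, folded t_def]
    by (simp add: algebra_simps power_add flip: power_mult_distrib)
  also have "\<dots> > 0"
  proof -
    have "sin t = 2 * sin (t / 2) * cos (t / 2)"
      using sin_double[of "t / 2"] by simp
    moreover have "sin (t / 2) < 1"
      using sin_monotone_2pi[of "t / 2" "pi / 2"] t by simp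
    ultimately have "sin t < 2 * cos (t / 2)"
      using cos_half by simp
    also have "\<dots> \<le> r ^ Suc n * ((1 + r) * cos (t / 2))"
    proof -
      have "1 * (2 * cos (t / 2)) \<le> r ^ Suc n * ((1 + r) * cos (t / 2))"
        using r cos_half by (intro mult_mono mult_right_mono one_le_power) auto
      then show ?thesis by simp
    qed
    finally have "sin t < r ^ Suc n * ((1 + r) * cos (t / 2))" .
    moreover have "\<bar>(-1) ^ (n + k) * sin t\<bar> = sin t"
      using sin by (simp add: abs_mult power_abs)
    ultimately show ?thesis
      by linarith
  qed
  finally have "0 < (-1) ^ k * poly (P n) z * ((1 - z + r\<^sup>2) * sin t)"
    by (simp add: ac_simps)
  then show ?thesis
    unfolding z_def[symmetric] t_def[symmetric]
    by (rule zero_less_mult_pos2[OF _ mult_pos_pos[OF Q sin]])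
qed

lemma sample_angle_less: "i < j \<Longrightarrow> sample_angle n i < sample_angle n j"
  by (simp add: sample_angle_def divide_strict_right_mono)

lemma equimod_point_sample_angle_mono:
  assumes "b > 0" "i < j" "j \<le> n"
  shows "equimod_point a b (cos (sample_angle n i)) < equimod_point a b (cos (sample_angle n j))"
  using assms sample_angle_bounds[of i n] sample_angle_bounds[of j n] sample_angle_less[of i j n]
  by (intro equimod_point_strict_antimono cos_monotone_0_pi) auto

lemma cos_sample_angle_bounds:
  assumes "k \<le> n"
  shows "- 1 < cos (sample_angle n k)" "cos (sample_angle n k) < 1"
  using sample_angle_bounds[OF assms] cos_monotone_0_pi[of 0 "sample_angle n k"] cos_monotone_0_pi[of "sample_angle n k" pi]
  by auto

lemma zeros_subset_zero_interval:
  assumes gen: "generated_by a b P" and b: "b \<ge> 1 + 2 * \<bar>a\<bar>"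
  shows "zeros (P n) \<subseteq> complex_of_real ` zero_interval a b"
proof -
  let ?y = "\<lambda>k. equimod_point a b (cos (sample_angle n k))"
  have bp: "b > 0" using b by linarith
  have "zeros (P n) \<subseteq> complex_of_real ` {?y 0<..<?y n}"
    using degree_generated_by[OF gen] equimod_point_sample_angle_mono[OF bp] generated_by_sign[OF gen b]
    by (rule zeros_subset_of_alternating_signs)
  also have "{?y 0<..<?y n} \<subseteq> zero_interval a b"
    using equimod_point_strict_antimono[OF bp, of "cos (sample_angle n 0)" 1 a]
      equimod_point_strict_antimono[OF bp, of "- 1" "cos (sample_angle n n)" a]
      cos_sample_angle_bounds[of 0 n] cos_sample_angle_bounds[of n n]
    unfolding zero_interval_equimod_point[OF bp] by auto
  finally show ?thesis by (simp add: image_mono)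
qed

text \<open>Neighbouring sample angles have distance \<open>2 \<pi> / (2 n + 3)\<close>.\<close>

lemma eventually_consecutive_sample_angles:
  assumes "0 \<le> \<alpha>" "\<alpha> < \<beta>" "\<beta> \<le> pi"
  shows "\<forall>\<^sub>F n in sequentially. \<exists>k. Suc k \<le> n \<and> \<alpha> < sample_angle n k \<and> sample_angle n (Suc k) < \<beta>"
proof -
  have "(\<lambda>n. 5 * pi / real (2 * n + 3)) \<longlonglongrightarrow> 0"
    using LIMSEQ_subseq_LIMSEQ[OF lim_const_over_n[of "5 * pi"], of "\<lambda>n. 2 * n + 3"]
    by (simp add: strict_mono_def o_def)
  then have "\<forall>\<^sub>F n in sequentially. 5 * pi / real (2 * n + 3) < \<beta> - \<alpha>"
    by (rule order_tendstoD) (use assms in simp)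
  then show ?thesis
  proof eventually_elim
    case (elim n)
    define N where "N = real (2 * n + 3)"
    have N: "N > 0"
      by (simp add: N_def)
    define t where "t = \<alpha> * N / pi"
    \<comment> \<open>Rounding up places \<open>2 k + 1\<close> in the window \<open>(t, t + 3)\<close>, so \<open>2 k + 3 < t + 5\<close>.\<close>
    define k where "k = nat \<lceil>t / 2\<rceil>"
    have "t \<ge> 0"
      using assms(1) by (simp add: t_def N_def)
    then have k: "t \<le> 2 * real k" "2 * real k < t + 2"
      unfolding k_def by linarith+
    have \<alpha>: "\<alpha> = t * pi / N"
      using N by (simp add: t_def)
    have "\<alpha> < sample_angle n k"
      unfolding \<alpha> sample_angle_def N_def[symmetric] using k N by (intro divide_strict_right_mono mult_strict_right_mono) auto
    moreover have "sample_angle n (Suc k) < \<beta>"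
    proof -
      have "sample_angle n (Suc k) = (2 * real k + 3) * pi / N"
        by (simp add: sample_angle_def N_def algebra_simps)
      also have "\<dots> \<le> (t + 5) * pi / N"
        using k N by (intro divide_right_mono mult_right_mono) auto
      also have "\<dots> = \<alpha> + 5 * pi / N"
        by (simp add: \<alpha> field_simps add_divide_distrib)
      also have "\<dots> < \<beta>"
        using elim by (simp add: N_def)
      finally show ?thesis .
    qed
    moreover have "Suc k \<le> n"
    proof -
      have "sample_angle n (Suc k) < pi"
        using \<open>sample_angle n (Suc k) < \<beta>\<close> assms by linarith
      then have "real (2 * Suc k + 1) < real (2 * n + 3)"
        by (simp add: sample_angle_def divide_less_eq)
      then show ?thesis by simp
    qed
    ultimately show ?case by blast
  qed
qed

lemma eventually_zero_in_subinterval: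
  assumes gen: "generated_by a b P" and b: "b \<ge> 1 + 2 * \<bar>a\<bar>"
    and uv: "u < v" "{u<..<v} \<subseteq> zero_interval a b"
  shows "\<forall>\<^sub>F n in sequentially. \<exists>x\<in>{u<..<v}. complex_of_real x \<in> zeros (P n)"
proof -
  have bp: "b > 0" using b by linarith
  obtain u' v' where uv': "u < u'" "u' < v'" "v' < v"
    using uv(1) by (meson dense)
  have "u' \<in> zero_interval a b" "v' \<in> zero_interval a b"
    using uv(2) uv' by auto
  then obtain x y where x: "- 1 < x" "x < 1" "equimod_point a b x = u'" and y: "- 1 < y" "y < 1" "equimod_point a b y = v'"
    using zero_interval_equimod_pointE[OF bp] by metis
  have "y < x"
    using equimod_point_strict_antimono[OF bp, of x y a] x(3) y(3) uv'(2) by (cases x y rule: linorder_cases) auto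
  then have "arccos x < arccos y"
    using x y by (intro arccos_less_arccos) auto
  then have "\<forall>\<^sub>F n in sequentially. \<exists>k. Suc k \<le> n \<and> arccos x < sample_angle n k \<and> sample_angle n (Suc k) < arccos y"
    using x y by (intro eventually_consecutive_sample_angles arccos_lbound arccos_ubound) auto
  then show ?thesis
  proof eventually_elim
    case (elim n)
    then obtain k where k: "Suc k \<le> n" "arccos x < sample_angle n k" "sample_angle n (Suc k) < arccos y"
      by blast
    let ?y = "\<lambda>k. equimod_point a b (cos (sample_angle n k))"
    have "cos (sample_angle n k) < cos (arccos x)"
      using k sample_angle_bounds[of k n] x by (intro cos_monotone_0_pi arccos_lbound) auto
    then have 1: "u' < ?y k"
      using equimod_point_strict_antimono[OF bp, of "cos (sample_angle n k)" x a] x by simp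
    have "cos (arccos y) < cos (sample_angle n (Suc k))"
      using k sample_angle_bounds[of "Suc k" n] y by (intro cos_monotone_0_pi arccos_ubound) auto
    then have 2: "?y (Suc k) < v'"
      using equimod_point_strict_antimono[OF bp, of y "cos (sample_angle n (Suc k))" a] y by simp
    have "poly (P n) (?y k) * poly (P n) (?y (Suc k)) < 0"
      using generated_by_sign[OF gen b, of k n] generated_by_sign[OF gen b, of "Suc k" n] k
      by (cases "even k") (simp_all add: mult_less_0_iff)
    then obtain r where "?y k < r" "r < ?y (Suc k)" "poly (P n) r = 0"
      using poly_IVT[OF equimod_point_sample_angle_mono[OF bp, of k "Suc k" n]] k by auto
    then show ?case
      using 1 2 uv' by (intro bexI[of _ r]) (auto simp: of_real_mem_zeros_iff)
  qed
qed

section \<open>Coefficientwise evaluation and differentiation in z\<close>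

text \<open>The derivatives in \<open>z\<close> at a point \<open>x\<close> of all \<open>P n\<close> at once form a power series in \<open>t\<close>. Evaluation is a
  ring homomorphism and differentiation a derivation of \<open>\<real>[z][[t]]\<close>, so these series can be computed
  from the generating function itself.\<close>

definition fps_eval :: "real \<Rightarrow> real poly fps \<Rightarrow> real fps" where
  "fps_eval x F = Abs_fps (\<lambda>n. poly (F $ n) x)"

definition fps_pderiv :: "real poly fps \<Rightarrow> real poly fps" where
  "fps_pderiv F = Abs_fps (\<lambda>n. pderiv (F $ n))"

lemma fps_eval_nth [simp]: "fps_eval x F $ n = poly (F $ n) x"
  by (simp add: fps_eval_def)

lemma fps_pderiv_nth [simp]: "fps_pderiv F $ n = pderiv (F $ n)"
  by (simp add: fps_pderiv_def)

lemma fps_eval_add: "fps_eval x (F + G) = fps_eval x F + fps_eval x G"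
  by (simp add: fps_eq_iff)

lemma fps_eval_mult: "fps_eval x (F * G) = fps_eval x F * fps_eval x G"
  by (simp add: fps_eq_iff fps_mult_nth poly_sum)

lemma fps_eval_1: "fps_eval x 1 = 1"
  by (simp add: fps_eq_iff)

lemma fps_eval_0: "fps_eval x 0 = 0"
  by (simp add: fps_eq_iff)

lemma fps_eval_X: "fps_eval x fps_X = fps_X"
  by (simp add: fps_eq_iff fps_X_def)

lemma fps_eval_const: "fps_eval x (fps_const p) = fps_const (poly p x)"
  by (simp add: fps_eq_iff)

lemma fps_pderiv_add: "fps_pderiv (F + G) = fps_pderiv F + fps_pderiv G"
  by (simp add: fps_eq_iff pderiv_add)

lemma fps_pderiv_mult: "fps_pderiv (F * G) = F * fps_pderiv G + fps_pderiv F * G"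
  by (simp add: fps_eq_iff fps_mult_nth higher_pderiv_sum[where n = 1, simplified] pderiv_mult sum.distrib
      mult.commute[of "pderiv p" for p])

lemma fps_pderiv_const: "fps_pderiv (fps_const p) = fps_const (pderiv p)"
  by (simp add: fps_eq_iff)

lemma fps_pderiv_X: "fps_pderiv fps_X = 0"
  by (simp add: fps_eq_iff fps_X_def pderiv_1)

lemma fps_pderiv_1: "fps_pderiv 1 = 0"
  by (simp add: fps_eq_iff pderiv_1)

lemma fps_pderiv_0: "fps_pderiv 0 = 0"
  by (simp add: fps_eq_iff)

lemmas fps_eval_simps = fps_eval_add fps_eval_mult fps_eval_1 fps_eval_0 fps_eval_X fps_eval_const
lemmas fps_pderiv_simps =
  fps_pderiv_add fps_pderiv_mult fps_pderiv_1 fps_pderiv_0 fps_pderiv_X fps_pderiv_const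

lemma fps_pderiv_funpow_nth: "(fps_pderiv ^^ k) F $ n = (pderiv ^^ k) (F $ n)"
  by (induction k) simp_all

lemma fps_pderiv_gen_denom:
  "fps_pderiv (gen_denom a b) = (fps_X + 1) * (fps_const [:a:] * fps_X ^ 2 + fps_X)"
  by (simp add: gen_denom_def fps_pderiv_simps power2_eq_square pderiv_pCons flip: one_pCons)

lemma fps_pderiv2_gen_denom: "fps_pderiv (fps_pderiv (gen_denom a b)) = 0"
  by (simp add: fps_pderiv_gen_denom fps_pderiv_simps power2_eq_square pderiv_pCons)

text \<open>The denominator \<open>D\<close> is affine in \<open>z\<close>, so the \<open>k\<close>-th derivative of \<open>1 / D\<close> is
  \<open>(-1)\<^sup>k k! D'\<^sup>k / D\<^sup>k\<^sup>+\<^sup>1\<close>; the factor \<open>1 + t\<close> common to \<open>D\<close> and \<open>D'\<close> cancels \<open>k\<close> times.\<close>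

lemma fps_eval_pderiv_generated_by:
  fixes q :: "real fps"
  assumes gen: "generated_by a b P"
    and q: "q = 1 + fps_const x * fps_X + fps_const (a * x + b) * fps_X ^ 2"
  shows "fps_eval x ((fps_pderiv ^^ k) (Abs_fps P)) =
    fps_const ((-1) ^ k * fact k) * fps_X ^ k * (1 + fps_const a * fps_X) ^ k *
      inverse ((1 + fps_X) * q ^ Suc k)"
proof -
  define S where "S = Abs_fps P"
  define D where "D = gen_denom a b"
  define D' where "D' = fps_pderiv D"
  have SD: "S * D = 1"
    using gen by (simp add: generated_by_def S_def D_def)
  have D'0: "fps_pderiv D' = 0"
    by (simp add: D'_def D_def fps_pderiv2_gen_denom)
  \<comment> \<open>Leibniz' rule applied to \<open>S D = 1\<close> has only two terms since \<open>D'' = 0\<close>.\<close>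
  have leib: "(fps_pderiv ^^ Suc k) S * D + of_nat (Suc k) * ((fps_pderiv ^^ k) S * D') = 0" for k
  proof (induction k)
    case 0
    have "fps_pderiv (S * D) = 0"
      unfolding SD by (rule fps_pderiv_1)
    then show ?case
      by (simp add: fps_pderiv_mult D'_def add.commute)
  next
    case (Suc k)
    have nat: "fps_pderiv (of_nat j) = 0" for j
      by (induction j) (simp_all add: fps_pderiv_simps)
    have "fps_pderiv ((fps_pderiv ^^ Suc k) S * D + of_nat (Suc k) * ((fps_pderiv ^^ k) S * D')) = 0"
      unfolding Suc by (rule fps_pderiv_0)
    then show ?case
      by (simp add: fps_pderiv_simps nat D'0 D'_def[symmetric] algebra_simps)
  qed
  define d where "d = (1 + fps_X) * q"
  have D: "fps_eval x D = d"
    by (simp add: D_def gen_denom_def fps_eval_simps d_def q power2_eq_square algebra_simps)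
  have D': "fps_eval x D' = (1 + fps_X) * fps_X * (1 + fps_const a * fps_X)"
    by (simp add: D'_def D_def fps_pderiv_gen_denom fps_eval_simps power2_eq_square algebra_simps)
  have q0: "q $ 0 = 1"
    by (simp add: q)
  then have iq: "q * inverse q = 1" and iX: "(1 + fps_X) * inverse (1 + fps_X :: real fps) = 1"
    and id: "d * inverse d = 1"
    by (auto intro!: inverse_mult_eq_1' simp: d_def)
  show ?thesis
    unfolding S_def[symmetric]
  proof (induction k)
    case 0
    have "fps_eval x S * d = 1"
      by (simp add: fps_eval_1 SD flip: D fps_eval_mult)
    then have "fps_eval x S = inverse d"
      by (metis id mult.left_commute mult_1_right mult.commute)
    then show ?case
      by (simp add: d_def)
  next
    case (Suc k)
    have nat: "fps_eval x (of_nat j) = of_nat j" for j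
      by (induction j) (simp_all add: fps_eval_simps)
    have "fps_eval x ((fps_pderiv ^^ Suc k) S * D + of_nat (Suc k) * ((fps_pderiv ^^ k) S * D')) = 0"
      unfolding leib by (rule fps_eval_0)
    then have "fps_eval x ((fps_pderiv ^^ Suc k) S) * d =
       - of_nat (Suc k) * fps_eval x ((fps_pderiv ^^ k) S) * fps_eval x D'"
      by (simp add: fps_eval_add fps_eval_mult nat D eq_neg_iff_add_eq_0 mult.assoc del: funpow.simps of_nat_Suc)
    then have "fps_eval x ((fps_pderiv ^^ Suc k) S) * (d * inverse d) =
       - of_nat (Suc k) * fps_eval x ((fps_pderiv ^^ k) S) * fps_eval x D' * inverse d"
      by (simp only: mult.assoc[symmetric])
    then have "fps_eval x ((fps_pderiv ^^ Suc k) S) =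
       - of_nat (Suc k) * fps_eval x ((fps_pderiv ^^ k) S) * fps_eval x D' * inverse d"
      unfolding id by simp
    also have "fps_eval x D' * inverse d =
        fps_X * (1 + fps_const a * fps_X) * inverse q * ((1 + fps_X) * inverse (1 + fps_X))"
      by (simp add: D' d_def fps_inverse_mult ac_simps)
    then have "- of_nat (Suc k) * fps_eval x ((fps_pderiv ^^ k) S) * fps_eval x D' * inverse d =
       - of_nat (Suc k) * fps_eval x ((fps_pderiv ^^ k) S) * (fps_X * (1 + fps_const a * fps_X) * inverse q)"
      unfolding iX by (simp add: mult.assoc)
    also have "\<dots> = fps_const (- real (Suc k) * ((-1) ^ k * fact k)) * fps_X ^ Suc k *
        (1 + fps_const a * fps_X) ^ Suc k * inverse ((1 + fps_X) * q ^ Suc (Suc k))"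
    proof -
      have c: "- of_nat (Suc k) = (fps_const (- real (Suc k)))"
        by (simp flip: fps_of_nat del: of_nat_Suc)
      show ?thesis
        unfolding Suc.IH c fps_const_mult[symmetric] by (simp add: fps_inverse_mult ac_simps)
    qed
    also have "- real (Suc k) * ((-1) ^ k * fact k) = (-1) ^ Suc k * fact (Suc k)"
      by (simp add: algebra_simps)
    finally show ?case .
  qed
qed


section \<open>Coefficient asymptotics at a pair of opposite poles\<close>

text \<open>The coefficients of \<open>F\<close> grow like \<open>w\<^sup>n n\<^sup>m (L + M (-1)\<^sup>n)\<close>: for a rational series, \<open>L\<close> and \<open>M\<close> are, up to
  constants, the leading Laurent coefficients at the poles \<open>1 / w\<close> and \<open>- 1 / w\<close> of order \<open>m + 1\<close>.
  Multiplication by a function regular at both poles and with a larger radius of convergence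
  multiplies \<open>L\<close> and \<open>M\<close> by its values there. The rules below state this for the factors \<open>X\<close>,
  \<open>1 + a X\<close> and \<open>1 / (1 - \<rho> X)\<close>.\<close>

definition osc_asymp :: "real \<Rightarrow> nat \<Rightarrow> real \<Rightarrow> real \<Rightarrow> real fps \<Rightarrow> bool" where
  "osc_asymp w m L M F \<longleftrightarrow>
     (\<lambda>n. F $ n / (w ^ n * real n ^ m) - (L + M * (-1) ^ n)) \<longlonglongrightarrow> 0"

lemma perturbed_contraction_tendsto_0:
  fixes y c e :: "nat \<Rightarrow> real"
  assumes rec: "\<And>n. y (Suc n) = c n * y n + e n"
    and c: "c \<longlonglongrightarrow> c0" and c0: "\<bar>c0\<bar> < 1" and e: "e \<longlonglongrightarrow> 0"
  shows "y \<longlonglongrightarrow> 0"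
proof -
  obtain k where k: "\<bar>c0\<bar> < k" "k < 1"
    using c0 dense by blast
  have "(\<lambda>n. \<bar>c n\<bar>) \<longlonglongrightarrow> \<bar>c0\<bar>"
    using c by (rule tendsto_rabs)
  then have ck: "\<forall>\<^sub>F n in sequentially. \<bar>c n\<bar> < k"
    using k(1) by (rule order_tendstoD)
  show ?thesis
  proof (rule LIMSEQ_I)
    fix r :: real assume r: "0 < r"
    define d where "d = r / 2 * (1 - k)"
    have "d > 0"
      using r k by (simp add: d_def)
    have "(\<lambda>n. \<bar>e n\<bar>) \<longlonglongrightarrow> 0"
      using e by (rule tendsto_rabs_zero)
    then have "\<forall>\<^sub>F n in sequentially. \<bar>e n\<bar> < d"
      using \<open>d > 0\<close> by (rule order_tendstoD)
    with ck have "\<forall>\<^sub>F n in sequentially. \<bar>c n\<bar> < k \<and> \<bar>e n\<bar> < d"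
      by (rule eventually_conj)
    then obtain N where N: "\<And>n. n \<ge> N \<Longrightarrow> \<bar>c n\<bar> < k \<and> \<bar>e n\<bar> < d"
      unfolding eventually_sequentially by blast
    have bound: "\<bar>y (N + j)\<bar> \<le> k ^ j * \<bar>y N\<bar> + r / 2" for j
    proof (induction j)
      case 0
      then show ?case using r by simp
    next
      case (Suc j)
      have "\<bar>y (N + Suc j)\<bar> \<le> \<bar>c (N + j)\<bar> * \<bar>y (N + j)\<bar> + \<bar>e (N + j)\<bar>"
        using rec[of "N + j"] abs_triangle_ineq[of "c (N + j) * y (N + j)" "e (N + j)"]
        by (simp add: abs_mult)
      also have "\<dots> \<le> k * (k ^ j * \<bar>y N\<bar> + r / 2) + d"
        using N[of "N + j"] Suc k by (intro add_mono mult_mono) auto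
      also have "\<dots> = k ^ Suc j * \<bar>y N\<bar> + r / 2"
        by (simp add: d_def field_simps)
      finally show ?case .
    qed
    have "\<bar>k\<bar> < 1"
      using k by auto
    then have "(\<lambda>j. k ^ j * \<bar>y N\<bar>) \<longlonglongrightarrow> 0"
      by (intro tendsto_mult_left_zero LIMSEQ_power_zero) simp
    then have "\<forall>\<^sub>F j in sequentially. k ^ j * \<bar>y N\<bar> < r / 2"
      by (rule order_tendstoD) (use r in simp)
    then obtain J where J: "\<And>j. j \<ge> J \<Longrightarrow> k ^ j * \<bar>y N\<bar> < r / 2"
      unfolding eventually_sequentially by blast
    show "\<exists>no. \<forall>n\<ge>no. norm (y n - 0) < r"
    proof (intro exI[of _ "N + J"] allI impI)
      fix n assume "N + J \<le> n"
      then have "J \<le> n - N" "N + (n - N) = n"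
        by simp_all
      with J[of "n - N"] bound[of "n - N"] show "norm (y n - 0) < r"
        by simp
    qed
  qed
qed

lemma tendsto_ratio_Suc_power: "(\<lambda>n. (real n / real (Suc n)) ^ m) \<longlonglongrightarrow> 1"
proof -
  have "(\<lambda>n. (real n / real (Suc n)) ^ m) \<longlonglongrightarrow> 1 ^ m"
    by (intro tendsto_power LIMSEQ_n_over_Suc_n)
  then show ?thesis by simp
qed

lemma tendsto_0_times_sign: "f \<longlonglongrightarrow> 0 \<Longrightarrow> (\<lambda>n. f n * (C * (-1) ^ n) :: real) \<longlonglongrightarrow> 0"
  by (rule tendsto_rabs_zero_cancel) (auto simp: abs_mult power_abs intro!: tendsto_eq_intros)

lemma osc_asymp_add:
  "osc_asymp w m L M F \<Longrightarrow> osc_asymp w m L' M' G \<Longrightarrow> osc_asymp w m (L + L') (M + M') (F + G)"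
  unfolding osc_asymp_def by (drule (1) tendsto_add) (simp add: algebra_simps add_divide_distrib)

lemma osc_asymp_const_mult:
  "osc_asymp w m L M F \<Longrightarrow> osc_asymp w m (C * L) (C * M) (fps_const C * F)"
  unfolding osc_asymp_def by (drule tendsto_mult[OF tendsto_const[of C]]) (simp add: algebra_simps)

lemma osc_asymp_X_mult:
  assumes F: "osc_asymp w m L M F" and w: "w > 0"
  shows "osc_asymp w m (L / w) (- M / w) (fps_X * F)"
proof -
  define f where "f n = F $ n / (w ^ n * real n ^ m) - (L + M * (-1) ^ n)" for n
  define d where "d n = (real n / real (Suc n)) ^ m / w" for n
  have f: "f \<longlonglongrightarrow> 0"
    using F unfolding osc_asymp_def f_def .
  have d: "d \<longlonglongrightarrow> 1 / w"
    unfolding d_def using w by (intro tendsto_divide tendsto_ratio_Suc_power tendsto_const) simp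
  then have d0: "(\<lambda>n. d n - 1 / w) \<longlonglongrightarrow> 0"
    by (rule LIM_zero)
  have "(\<lambda>n. d n * f n + (d n - 1 / w) * L + (d n - 1 / w) * (M * (-1) ^ n)) \<longlonglongrightarrow> 0"
    using tendsto_add[OF tendsto_add[OF tendsto_mult[OF d f] tendsto_mult[OF d0 tendsto_const[of L]]]
        tendsto_0_times_sign[OF d0, of M]] by simp
  moreover have "\<forall>\<^sub>F n in sequentially.
      d n * f n + (d n - 1 / w) * L + (d n - 1 / w) * (M * (-1) ^ n) =
      (fps_X * F) $ Suc n / (w ^ Suc n * real (Suc n) ^ m) - (L / w + - M / w * (-1) ^ Suc n)"
    using eventually_gt_at_top[of 0]
  proof eventually_elim
    case (elim n)
    have "d n * (F $ n / (w ^ n * real n ^ m)) = F $ n / (w ^ Suc n * real (Suc n) ^ m)"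
      using elim by (simp add: d_def power_divide)
    then show ?case
      by (simp add: f_def algebra_simps)
  qed
  ultimately have "(\<lambda>n. (fps_X * F) $ Suc n / (w ^ Suc n * real (Suc n) ^ m)
      - (L / w + - M / w * (-1) ^ Suc n)) \<longlonglongrightarrow> 0"
    by (rule Lim_transform_eventually)
  then show ?thesis
    unfolding osc_asymp_def by (rule LIMSEQ_imp_Suc)
qed

lemma osc_asymp_linear_mult:
  assumes F: "osc_asymp w m L M F" and w: "w > 0"
  shows "osc_asymp w m (L * (1 + a / w)) (M * (1 - a / w)) (F * (1 + fps_const a * fps_X))"
proof -
  have "osc_asymp w m (L + a * (L / w)) (M + a * (- M / w)) (F + fps_const a * (fps_X * F))"
    by (intro osc_asymp_add osc_asymp_const_mult osc_asymp_X_mult F w)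
  then show ?thesis
    by (simp add: algebra_simps)
qed

text \<open>The coefficients satisfy \<open>G\<^sub>n\<^sub>+\<^sub>1 = \<rho> G\<^sub>n + F\<^sub>n\<^sub>+\<^sub>1\<close>. After normalisation this is an eventually contracting
  recurrence for the error term, with multiplier tending to \<open>\<rho> / w\<close>.\<close>

lemma osc_asymp_div_linear:
  assumes F: "osc_asymp w m L M F" and w: "w > 0" and rho: "\<bar>\<rho>\<bar> < w"
    and G: "G * (1 - fps_const \<rho> * fps_X) = F"
  shows "osc_asymp w m (L / (1 - \<rho> / w)) (M / (1 + \<rho> / w)) G"
proof -
  define L' M' where "L' = L / (1 - \<rho> / w)" and "M' = M / (1 + \<rho> / w)"
  have "\<bar>\<rho> / w\<bar> < 1"
    using w rho by simp
  then have "1 - \<rho> / w \<noteq> 0" "1 + \<rho> / w \<noteq> 0"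
    by linarith+
  then have L: "L = L' * (1 - \<rho> / w)" and M: "M = M' * (1 + \<rho> / w)"
    by (simp_all add: L'_def M'_def)
  have step: "F $ Suc n = G $ Suc n - \<rho> * G $ n" for n
    by (simp flip: G add: algebra_simps)
  define f where "f n = F $ n / (w ^ n * real n ^ m) - (L + M * (-1) ^ n)" for n
  define y where "y n = G $ n / (w ^ n * real n ^ m) - (L' + M' * (-1) ^ n)" for n
  define d where "d n = (real n / real (Suc n)) ^ m * (\<rho> / w)" for n
  define e where "e = (\<lambda>n. f (Suc n) + (d n - \<rho> / w) * L' + (d n - \<rho> / w) * (M' * (- 1) ^ n))"
  have f: "f \<longlonglongrightarrow> 0"
    using F unfolding osc_asymp_def f_def .
  have "d \<longlonglongrightarrow> 1 * (\<rho> / w)"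
    unfolding d_def by (intro tendsto_mult tendsto_ratio_Suc_power tendsto_const)
  then have d: "d \<longlonglongrightarrow> \<rho> / w"
    by simp
  then have d0: "(\<lambda>n. d n - \<rho> / w) \<longlonglongrightarrow> 0"
    by (rule LIM_zero)
  have e: "e \<longlonglongrightarrow> 0"
    using tendsto_add[OF tendsto_add[OF LIMSEQ_Suc[OF f] tendsto_mult[OF d0 tendsto_const[of L']]]
        tendsto_0_times_sign[OF d0, of M']] by (simp add: e_def)
  have rec: "y (Suc n) = d n * y n + e n" if "n > 0" for n
  proof -
    have "d n * (G $ n / (w ^ n * real n ^ m)) = \<rho> * G $ n / (w ^ Suc n * real (Suc n) ^ m)"
      using that by (simp add: d_def power_divide)
    then have "G $ Suc n / (w ^ Suc n * real (Suc n) ^ m) =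
        d n * (G $ n / (w ^ n * real n ^ m)) + F $ Suc n / (w ^ Suc n * real (Suc n) ^ m)"
      using step[of n] by (simp add: diff_divide_distrib)
    then show ?thesis
      by (simp add: y_def e_def f_def L M algebra_simps)
  qed
  \<comment> \<open>The recurrence starts at \<open>1\<close>: for \<open>n = 0\<close> the normalising factor \<open>n\<^sup>m\<close> may vanish.\<close>
  have "(\<lambda>n. y (Suc n)) \<longlonglongrightarrow> 0"
  proof (rule perturbed_contraction_tendsto_0)
    show "y (Suc (Suc n)) = d (Suc n) * y (Suc n) + e (Suc n)" for n
      by (rule rec) simp
    show "(\<lambda>n. d (Suc n)) \<longlonglongrightarrow> \<rho> / w" "(\<lambda>n. e (Suc n)) \<longlonglongrightarrow> 0"
      using d e by (auto intro: LIMSEQ_Suc)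
    show "\<bar>\<rho> / w\<bar> < 1"
      using w rho by simp
  qed
  then show ?thesis
    unfolding osc_asymp_def y_def L'_def M'_def by (rule LIMSEQ_imp_Suc)
qed

lemma tendsto_choose_over_power: "(\<lambda>n. real ((n + k) choose k) / real n ^ k) \<longlonglongrightarrow> 1 / fact k"
proof (induction k)
  case 0
  then show ?case by simp
next
  case (Suc k)
  have aux: "B / p * ((1 + s / x) / s) = (x + s) * B / s / (x * p)"
    if "x > 0" "s > 0" "p > 0" for B p s x :: real
    using that by (simp add: field_simps)
  have "(\<lambda>n. real ((n + k) choose k) / real n ^ k * ((1 + real (Suc k) / real n) / real (Suc k)))
      \<longlonglongrightarrow> 1 / fact k * ((1 + 0) / real (Suc k))"
    by (intro tendsto_mult tendsto_divide tendsto_add Suc.IH tendsto_const lim_const_over_n) auto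
  moreover have "\<forall>\<^sub>F n in sequentially.
      real ((n + k) choose k) / real n ^ k * ((1 + real (Suc k) / real n) / real (Suc k)) =
      real ((n + Suc k) choose Suc k) / real n ^ Suc k"
    using eventually_gt_at_top[of 0]
  proof eventually_elim
    case (elim n)
    have "((n + Suc k) choose Suc k) * Suc k = (n + Suc k) * ((n + k) choose k)"
      using Suc_times_binomial_eq[of "n + k" k] by (simp only: add_Suc_right)
    then have "real ((n + Suc k) choose Suc k) * real (Suc k) = real (n + Suc k) * real ((n + k) choose k)"
      by (metis of_nat_mult)
    then have eq: "real ((n + Suc k) choose Suc k) =
        (real n + real (Suc k)) * real ((n + k) choose k) / real (Suc k)"
      by (simp only: eq_divide_eq of_nat_add) simp
    show ?case
      unfolding eq power_Suc by (rule aux) (use elim in simp_all)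
  qed
  ultimately show ?case
    by (simp add: Lim_transform_eventually field_simps)
qed

definition pole_pair :: "real \<Rightarrow> nat \<Rightarrow> nat \<Rightarrow> real fps" where
  "pole_pair w i j = inverse ((1 - fps_const w * fps_X) ^ i * (1 + fps_const w * fps_X) ^ j)"

lemma osc_asymp_cong:
  "osc_asymp w m L M F \<Longrightarrow> L = L' \<Longrightarrow> M = M' \<Longrightarrow> F = G \<Longrightarrow> osc_asymp w m L' M' G"
  by simp

lemma inverse_one_minus_power_nth:
  fixes c :: real
  shows "inverse ((1 - fps_const c * fps_X) ^ Suc k) $ n = real ((n + k) choose k) * c ^ n"
proof -
  have "inverse ((1 - fps_const c * fps_X) ^ Suc k) $ n = real ((k + n) choose n) * c ^ n"
    by (subst one_minus_const_fps_X_neg_power') simp_all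
  also have "(k + n) choose n = (n + k) choose k"
    using binomial_symmetric[of n "k + n"] by (simp add: add.commute)
  finally show ?thesis .
qed

lemma tendsto_choose_over_higher_power:
  assumes "k \<le> m"
  shows "(\<lambda>n. real ((n + k) choose k) / real n ^ m) \<longlonglongrightarrow> (if k = m then 1 / fact m else 0)"
proof -
  have "(\<lambda>n. real ((n + k) choose k) / real n ^ k * inverse (real n) ^ (m - k)) 
     \<longlonglongrightarrow> 1 / fact k * 0 ^ (m - k)"
    by (intro tendsto_mult tendsto_choose_over_power tendsto_power lim_inverse_n)
  then have "(\<lambda>n. real ((n + k) choose k) / real n ^ k * inverse (real n) ^ (m - k)) 
     \<longlonglongrightarrow> (if k = m then 1 / fact m else 0)"
    using assms by (auto simp: power_0_left split: if_splits)
  moreover have "real ((n + k) choose k) / real n ^ k * inverse (real n) ^ (m - k)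
      = real ((n + k) choose k) / real n ^ m" for n
  proof -
    have "real n ^ m = real n ^ k * real n ^ (m - k)"
      using assms by (simp flip: power_add)
    then show ?thesis
      by (simp add: power_inverse divide_inverse)
  qed
  ultimately show ?thesis
    by simp
qed

text \<open>The identity \<open>1 / ((1 - u) (1 + u)) = (1 / (1 - u) + 1 / (1 + u)) / 2\<close> lowers one of the two pole orders
  in each summand, until a single pole is left, whose coefficients are binomial. If \<open>m + 1\<close> exceeds
  the order of a pole, that pole does not contribute on the scale \<open>n\<^sup>m\<close>.\<close>

lemma osc_asymp_pole_pair:
  assumes w: "w > 0" and "i \<le> Suc m" "j \<le> Suc m" "i + j > 0"
  shows "osc_asymp w m (if i = Suc m then 1 / (fact m * 2 ^ j) else 0)
           (if j = Suc m then 1 / (fact m * 2 ^ i) else 0) (pole_pair w i j)"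
  using assms(2-)
proof (induction "i + j" arbitrary: i j rule: less_induct)
  case less
  consider k where "i = Suc k" "j = 0" | k where "i = 0" "j = Suc k"
    | i' j' where "i = Suc i'" "j = Suc j'"
    using less.prems by (metis add_is_0 nat_less_le not0_implies_Suc)
  then show ?case
  proof cases
    case 1
    have "pole_pair w i j $ n / (w ^ n * real n ^ m) = real ((n + k) choose k) / real n ^ m" for n
      using w 1 by (simp add: pole_pair_def inverse_one_minus_power_nth del: power_Suc)
    then show ?thesis
      using tendsto_choose_over_higher_power[of k m] 1 less.prems
      by (auto simp: osc_asymp_def LIM_zero_iff)
  next
    case 2
    have *: "pole_pair w i j $ n / (w ^ n * real n ^ m) = real ((n + k) choose k) / real n ^ m * (-1) ^ n" for n
      using w 2 inverse_one_minus_power_nth[of "-w" k n]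
      by (simp add: pole_pair_def power_minus[of w] flip: fps_const_neg del: power_Suc)
    define d where "d n = real ((n + k) choose k) / real n ^ m - (if k = m then 1 / fact m else 0)" for n
    have "d \<longlonglongrightarrow> 0"
      using tendsto_choose_over_higher_power[of k m] 2 less.prems unfolding d_def by (intro LIM_zero) auto
    then have "(\<lambda>n. d n * (1 * (-1) ^ n)) \<longlonglongrightarrow> 0"
      by (rule tendsto_0_times_sign)
    then show ?thesis
      using 2 unfolding osc_asymp_def * d_def by (auto simp: algebra_simps)
  next
    case 3
    let ?P = "1 - fps_const w * fps_X" and ?M = "1 + fps_const w * fps_X"
    have split: "pole_pair w i j = fps_const (1/2) * (pole_pair w i j' + pole_pair w i' j)"
    proof -
      have p: "pole_pair w i j' = pole_pair w i j * ?M" "pole_pair w i' j = pole_pair w i j * ?P"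
        using 3 by (simp_all add: pole_pair_def fps_inverse_mult inverse_mult_eq_1' ac_simps)
      have "?M + ?P = fps_const 2"
        by (simp add: numeral_fps_const)
      then have "fps_const (1/2) * (pole_pair w i j' + pole_pair w i' j)
          = fps_const (1/2) * (pole_pair w i j * fps_const 2)"
        unfolding p distrib_left[symmetric] by simp
      also have "\<dots> = pole_pair w i j"
        by (simp add: mult.commute mult.left_commute)
      finally show ?thesis by simp
    qed
    have "osc_asymp w m (if i = Suc m then 1 / (fact m * 2 ^ j') else 0)
           (if j' = Suc m then 1 / (fact m * 2 ^ i) else 0) (pole_pair w i j')"
      "osc_asymp w m (if i' = Suc m then 1 / (fact m * 2 ^ j) else 0)
           (if j = Suc m then 1 / (fact m * 2 ^ i') else 0) (pole_pair w i' j)"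
      by (rule less.hyps; use 3 less.prems in simp)+
    from osc_asymp_const_mult[OF osc_asymp_add[OF this], of "1/2"]
    show ?thesis
      by (rule osc_asymp_cong) (use 3 less.prems split in auto)
  qed
qed

lemma osc_asymp_X_power_mult:
  assumes "osc_asymp w m L M F" "w > 0"
  shows "osc_asymp w m ((1 / w) ^ k * L) ((- 1 / w) ^ k * M) (fps_X ^ k * F)"
proof (induction k)
  case (Suc k)
  show ?case
    by (rule osc_asymp_cong[OF osc_asymp_X_mult[OF Suc assms(2)]]) (simp_all add: mult.assoc)
qed (simp add: assms)

lemma osc_asymp_linear_power_mult:
  assumes "osc_asymp w m L M F" "w > 0"
  shows "osc_asymp w m ((1 + a / w) ^ k * L) ((1 - a / w) ^ k * M)
    ((1 + fps_const a * fps_X) ^ k * F)"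
proof (induction k)
  case (Suc k)
  show ?case
    by (rule osc_asymp_cong[OF osc_asymp_linear_mult[OF Suc assms(2), of a]]) (simp_all add: ac_simps)
qed (simp add: assms)

lemma osc_asymp_linear_power_div:
  assumes "osc_asymp w m L M F" "w > 0" "\<bar>\<rho>\<bar> < w"
  shows "osc_asymp w m (L / (1 - \<rho> / w) ^ k) (M / (1 + \<rho> / w) ^ k)
    (F * inverse ((1 - fps_const \<rho> * fps_X) ^ k))"
proof (induction k)
  case (Suc k)
  let ?l = "1 - fps_const \<rho> * fps_X"
  have "F * inverse (?l ^ Suc k) * ?l = F * inverse (?l ^ k) * (?l * inverse ?l)"
    by (simp add: fps_inverse_mult ac_simps)
  also have "\<dots> = F * inverse (?l ^ k)"
    by (subst inverse_mult_eq_1') simp_all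
  finally have eq: "F * inverse (?l ^ Suc k) * ?l = F * inverse (?l ^ k)" .
  show ?case
    by (rule osc_asymp_cong[OF osc_asymp_div_linear[OF Suc assms(2,3) eq]])
      (simp_all add: mult.commute)
qed (simp add: assms)

lemma osc_asymp_even:
  assumes "osc_asymp w m L M F"
  shows "(\<lambda>n. F $ (2 * n) / (w ^ (2 * n) * real (2 * n) ^ m)) \<longlonglongrightarrow> L + M"
proof -
  have "strict_mono (\<lambda>n::nat. 2 * n)"
    by (simp add: strict_mono_def)
  from LIMSEQ_subseq_LIMSEQ[OF assms[unfolded osc_asymp_def] this]
  have "(\<lambda>n. F $ (2 * n) / (w ^ (2 * n) * real (2 * n) ^ m) - (L + M)) \<longlonglongrightarrow> 0"
    by (simp add: o_def)
  then show ?thesis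
    by (rule LIM_zero_cancel)
qed

text \<open>Both sides are normalised by the same factor, at index \<open>n\<close> the square of \<open>w\<^sup>n n\<^sup>d\<^sup>+\<^sup>1\<close>, so the
  inequality passes to the limit. Along the even indices the two poles contribute with the same
  sign.\<close>

lemma osc_asymp_even_log_concave:
  fixes F0 F1 F2 :: "real fps"
  assumes F: "osc_asymp w d L0 M0 F0" "osc_asymp w (Suc d) L1 M1 F1" "osc_asymp w (Suc (Suc d)) L2 M2 F2"
    and le: "\<And>n. F0 $ n * F2 $ n \<le> (F1 $ n)\<^sup>2"
  shows "(L0 + M0) * (L2 + M2) \<le> (L1 + M1)\<^sup>2"
proof (rule LIMSEQ_le)
  let ?s = "\<lambda>m F n. F $ (2 * n) / (w ^ (2 * n) * real (2 * n) ^ m)"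
  show "(\<lambda>n. ?s d F0 n * ?s (Suc (Suc d)) F2 n) \<longlonglongrightarrow> (L0 + M0) * (L2 + M2)"
    by (intro tendsto_mult osc_asymp_even F)
  show "(\<lambda>n. (?s (Suc d) F1 n)\<^sup>2) \<longlonglongrightarrow> (L1 + M1)\<^sup>2"
    by (intro tendsto_power osc_asymp_even F)
  have "?s d F0 n * ?s (Suc (Suc d)) F2 n \<le> (?s (Suc d) F1 n)\<^sup>2" for n
  proof -
    define D where "D = (w ^ (2 * n) * real (2 * n) ^ Suc d)\<^sup>2"
    have "?s d F0 n * ?s (Suc (Suc d)) F2 n = F0 $ (2 * n) * F2 $ (2 * n) / D"
      by (simp add: D_def power2_eq_square ac_simps)
    also have "\<dots> \<le> (F1 $ (2 * n))\<^sup>2 / D"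
      by (intro divide_right_mono le) (simp add: D_def)
    also have "\<dots> = (?s (Suc d) F1 n)\<^sup>2"
      by (simp only: D_def power_divide)
    finally show ?thesis .
  qed
  then show "\<exists>N. \<forall>n\<ge>N. ?s d F0 n * ?s (Suc (Suc d)) F2 n \<le> (?s (Suc d) F1 n)\<^sup>2"
    by blast
qed


section \<open>Non-real zeros when b is small\<close>

text \<open>Laguerre's inequality at \<open>x\<close>, in the limit over even \<open>n\<close>. The \<open>k\<close>-th derivative gains a factor
  \<open>n\<^sup>k\<close> over \<open>P n\<close>, as its generating function has \<open>k\<close> additional copies of the quadratic \<open>q\<close> in the
  denominator; \<open>d\<close> is the exponent for \<open>P n\<close> itself.\<close>

lemma real_rooted_even_limits:
  fixes q :: "real fps"
  assumes gen: "generated_by a b P" and real: "\<And>n. zeros (P n) \<subseteq> \<real>"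
    and q: "q = 1 + fps_const x * fps_X + fps_const (a * x + b) * fps_X ^ 2"
    and w: "w > 0"
    and asymp: "\<And>k. osc_asymp w (d + k) (L k) (M k) (inverse ((1 + fps_X) * q ^ Suc k))"
  shows "(L 0 + M 0) * (2 * ((1 / w)\<^sup>2 * ((1 + a / w)\<^sup>2 * L 2) + (1 / w)\<^sup>2 * ((1 - a / w)\<^sup>2 * M 2)))
    \<le> (1 / w * ((1 + a / w) * L 1) - 1 / w * ((1 - a / w) * M 1))\<^sup>2"
proof -
  define E where "E k = fps_eval x ((fps_pderiv ^^ k) (Abs_fps P))" for k
  have E: "osc_asymp w (d + k) ((-1) ^ k * fact k * ((1 / w) ^ k * ((1 + a / w) ^ k * L k)))
      ((-1) ^ k * fact k * ((- 1 / w) ^ k * ((1 - a / w) ^ k * M k))) (E k)" for k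
    unfolding E_def fps_eval_pderiv_generated_by[OF gen q] mult.assoc
    by (intro osc_asymp_const_mult[where C = "(-1) ^ k * fact k", unfolded mult.assoc]
        osc_asymp_X_power_mult osc_asymp_linear_power_mult asymp w)
  have "E 0 $ n * E 2 $ n \<le> (E 1 $ n)\<^sup>2" for n
    using laguerre_inequality[OF real[of n], of x]
    by (simp add: E_def fps_pderiv_funpow_nth numeral_2_eq_2)
  moreover have "osc_asymp w d (L 0) (M 0) (E 0)"
    using E[of 0] by simp
  moreover have "osc_asymp w (Suc d) (- (1 / w * ((1 + a / w) * L 1))) (1 / w * ((1 - a / w) * M 1)) (E 1)"
    using E[of 1] by simp
  moreover have "osc_asymp w (Suc (Suc d)) (2 * ((1 / w)\<^sup>2 * ((1 + a / w)\<^sup>2 * L 2)))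
      (2 * ((1 / w)\<^sup>2 * ((1 - a / w)\<^sup>2 * M 2))) (E 2)"
    using E[of 2] by simp
  ultimately have "(L 0 + M 0) * (2 * ((1 / w)\<^sup>2 * ((1 + a / w)\<^sup>2 * L 2)) + 2 * ((1 / w)\<^sup>2 * ((1 - a / w)\<^sup>2 * M 2)))
      \<le> (- (1 / w * ((1 + a / w) * L 1)) + 1 / w * ((1 - a / w) * M 1))\<^sup>2"
    by (intro osc_asymp_even_log_concave)
  then show ?thesis
    by (simp only: distrib_left uminus_add_conv_diff power2_commute)
qed

text \<open>At \<open>z = - (1 + b) / (1 + a)\<close> the quadratic is \<open>(1 - t) (1 - \<rho> t)\<close>, and the hypotheses say exactly that
  \<open>|\<rho>| < 1\<close>. The poles \<open>1\<close> and \<open>-1\<close> dominate, but only the one at \<open>1\<close> moves with \<open>z\<close>; it alone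
  contributes to the derivatives, and it violates the limiting inequality by the share of the pole
  \<open>-1\<close> in \<open>P n\<close>.\<close>

lemma not_real_rooted_pole_at_1:
  assumes gen: "generated_by a b P" and a: "a \<ge> 0" and b: "- 1 < b" "b < 1 + 2 * a"
  shows "\<exists>n. \<not> zeros (P n) \<subseteq> \<real>"
proof (rule ccontr)
  assume "\<not> ?thesis"
  then have real: "\<And>n. zeros (P n) \<subseteq> \<real>"
    by blast
  define \<rho> where "\<rho> = (b - a) / (1 + a)"
  have rho: "\<bar>\<rho>\<bar> < 1"
    using a b by (simp add: \<rho>_def abs_less_iff divide_less_eq less_divide_eq)
  have x: "a * - (1 + \<rho>) + b = \<rho>"
    using a by (simp add: \<rho>_def divide_simps) (simp add: algebra_simps)
  define q :: "real fps" where "q = (1 - fps_X) * (1 - fps_const \<rho> * fps_X)"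
  have q: "q = 1 + fps_const (- (1 + \<rho>)) * fps_X + fps_const (a * - (1 + \<rho>) + b) * fps_X ^ 2"
    unfolding x q_def by (simp add: algebra_simps power2_eq_square flip: fps_const_neg fps_const_add)
  have eq: "inverse ((1 + fps_X) * q ^ Suc k) =
      pole_pair 1 (Suc k) 1 * inverse ((1 - fps_const \<rho> * fps_X) ^ Suc k)" for k
    by (simp add: q_def pole_pair_def power_mult_distrib fps_inverse_mult ac_simps)
  have asymp: "osc_asymp 1 (0 + k) (1 / (fact k * 2) / (1 - \<rho>) ^ Suc k)
      ((if k = 0 then 1 / 2 else 0) / (1 + \<rho>) ^ Suc k) (inverse ((1 + fps_X) * q ^ Suc k))" for k
    unfolding eq
    by (rule osc_asymp_cong[OF osc_asymp_linear_power_div[OF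
          osc_asymp_pole_pair[of 1 "Suc k" "0 + k" 1], of \<rho> "Suc k"]])
      (use rho in auto)
  from real_rooted_even_limits[OF gen real q _ asymp] have
    "(1 / (2 * (1 - \<rho>)) + 1 / (2 * (1 + \<rho>))) * ((1 + a)\<^sup>2 / (2 * (1 - \<rho>) ^ 3))
      \<le> ((1 + a) / (2 * (1 - \<rho>)\<^sup>2))\<^sup>2"
    by (simp add: numeral_2_eq_2 numeral_3_eq_3)
  moreover have "(A / (2 * u\<^sup>2))\<^sup>2 = 1 / (2 * u) * (A\<^sup>2 / (2 * u ^ 3))" for A u :: real
    by (simp add: power2_eq_square power3_eq_cube)
  moreover have "1 / (2 * (1 + \<rho>)) * ((1 + a)\<^sup>2 / (2 * (1 - \<rho>) ^ 3)) > 0"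
    using rho a by (intro mult_pos_pos divide_pos_pos zero_less_power) auto
  ultimately show False
    by (simp only: distrib_right)
qed

text \<open>When the series of the \<open>k\<close>-th derivatives has a dominant pole of order \<open>k + 2\<close> at \<open>-1\<close>, the three limits are, up to the
  common geometric weights, \<open>1\<close>, \<open>1 / 2\<close> and \<open>1 / 3\<close>, the Taylor data of \<open>(e\<^sup>s - 1) / s\<close>; and
  \<open>1 / 3 > (1 / 2)\<^sup>2\<close>. The rate of the exponential is proportional to \<open>1 - a\<close>.\<close>

lemma not_real_rooted_of_multiple_pole_at_minus_1:
  assumes gen: "generated_by a b P" and real: "\<And>n. zeros (P n) \<subseteq> \<real>"
    and q: "q = 1 + fps_const x * fps_X + fps_const (a * x + b) * fps_X ^ 2"
    and a: "a \<noteq> 1" and c: "c > 0"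
    and asymp: "\<And>k. osc_asymp 1 (1 + k) 0 (1 / (fact (Suc k) * c ^ Suc k)) (inverse ((1 + fps_X) * q ^ Suc k))"
  shows False
proof -
  define T where "T = (1 - a)\<^sup>2 / c ^ 4"
  have "1 / c * (2 * ((1 - a)\<^sup>2 * (1 / (6 * c ^ 3)))) \<le> ((1 - a) * (1 / (2 * c\<^sup>2)))\<^sup>2"
    using real_rooted_even_limits[OF gen real q _ asymp] by (simp add: numeral_2_eq_2 numeral_3_eq_3)
  moreover have "1 / c * (2 * ((1 - a)\<^sup>2 * (1 / (6 * c ^ 3)))) = T / 3"
    by (simp add: T_def eval_nat_numeral)
  moreover have "((1 - a) * (1 / (2 * c\<^sup>2)))\<^sup>2 = T / 4"
    by (simp add: T_def power_divide power_mult_distrib)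
  moreover have "T > 0"
    using a c by (simp add: T_def)
  ultimately show False
    by linarith
qed

text \<open>At \<open>z = (1 + b) / (1 - a)\<close> the quadratic is \<open>(1 + t) (1 - \<rho> t)\<close>, and \<open>-1 < b < 1 - 2 a\<close> says exactly
  that \<open>|\<rho>| < 1\<close>.\<close>

lemma not_real_rooted_pole_at_minus_1:
  assumes gen: "generated_by a b P" and a: "a < 0" and b: "- 1 < b" "b < 1 - 2 * a"
  shows "\<exists>n. \<not> zeros (P n) \<subseteq> \<real>"
proof (rule ccontr)
  assume "\<not> ?thesis"
  then have real: "\<And>n. zeros (P n) \<subseteq> \<real>"
    by blast
  define \<rho> where "\<rho> = - (b + a) / (1 - a)"
  have rho: "\<bar>\<rho>\<bar> < 1"
    using a b by (simp add: \<rho>_def abs_less_iff divide_less_eq less_divide_eq)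
  have x: "a * (1 - \<rho>) + b = - \<rho>"
    using a by (simp add: \<rho>_def divide_simps) (simp add: algebra_simps)
  define q :: "real fps" where "q = (1 + fps_X) * (1 - fps_const \<rho> * fps_X)"
  have q: "q = 1 + fps_const (1 - \<rho>) * fps_X + fps_const (a * (1 - \<rho>) + b) * fps_X ^ 2"
    unfolding x q_def by (simp add: algebra_simps power2_eq_square flip: fps_const_neg fps_const_sub)
  have eq: "inverse ((1 + fps_X) * q ^ Suc k) =
      pole_pair 1 0 (Suc (Suc k)) * inverse ((1 - fps_const \<rho> * fps_X) ^ Suc k)" for k
    by (simp add: q_def pole_pair_def power_mult_distrib fps_inverse_mult ac_simps)
  have asymp: "osc_asymp 1 (1 + k) 0 (1 / (fact (Suc k) * (1 + \<rho>) ^ Suc k))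
      (inverse ((1 + fps_X) * q ^ Suc k))" for k
    unfolding eq
    by (rule osc_asymp_cong[OF osc_asymp_linear_power_div[OF
          osc_asymp_pole_pair[of 1 0 "1 + k" "Suc (Suc k)"], of \<rho> "Suc k"]])
      (use rho in auto)
  show False
    by (rule not_real_rooted_of_multiple_pole_at_minus_1[OF gen real q _ _ asymp]) (use a rho in auto)
qed

text \<open>At \<open>z = 0\<close> all poles lie on the unit circle, and the pole \<open>-1\<close> exceeds the pole \<open>1\<close> in order by one.\<close>

lemma not_real_rooted_three_unit_poles:
  assumes gen: "generated_by a (- 1) P" and a: "a \<noteq> 1"
  shows "\<exists>n. \<not> zeros (P n) \<subseteq> \<real>"
proof (rule ccontr)
  assume "\<not> ?thesis"
  then have real: "\<And>n. zeros (P n) \<subseteq> \<real>"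
    by blast
  define q :: "real fps" where "q = (1 - fps_X) * (1 + fps_X)"
  have q: "q = 1 + fps_const 0 * fps_X + fps_const (a * 0 + - 1) * fps_X ^ 2"
    unfolding q_def by (simp add: algebra_simps power2_eq_square flip: fps_const_neg)
  have eq: "inverse ((1 + fps_X) * q ^ Suc k) = pole_pair 1 (Suc k) (Suc (Suc k))" for k
    by (simp add: q_def pole_pair_def power_mult_distrib fps_inverse_mult ac_simps)
  have asymp: "osc_asymp 1 (1 + k) 0 (1 / (fact (Suc k) * 2 ^ Suc k))
      (inverse ((1 + fps_X) * q ^ Suc k))" for k
    unfolding eq by (rule osc_asymp_cong[OF osc_asymp_pole_pair]) auto
  show False
    by (rule not_real_rooted_of_multiple_pole_at_minus_1[OF gen real q _ _ asymp]) (use a in auto)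
qed

text \<open>At \<open>z = 0\<close> the quadratic is \<open>1 + b t\<^sup>2\<close>, whose zeros \<open>1 / w\<close> and \<open>- 1 / w\<close> with \<open>w\<^sup>2 = - b\<close> are both closer to
  \<open>0\<close> than \<open>-1\<close>. With positive weights \<open>B\<close> and \<open>C\<close> and two different rates, the limiting inequality
  would be the reverse of a strict Cauchy--Schwarz inequality.\<close>

lemma not_real_rooted_opposite_poles:
  assumes gen: "generated_by a b P" and b: "b < - 1"
  shows "\<exists>n. \<not> zeros (P n) \<subseteq> \<real>"
proof (rule ccontr)
  assume "\<not> ?thesis"
  then have real: "\<And>n. zeros (P n) \<subseteq> \<real>"
    by blast
  define w where "w = sqrt (- b)"
  have w: "w > 1" and w2: "w * w = - b"
    using b by (simp_all add: w_def)
  define q :: "real fps" where "q = (1 - fps_const w * fps_X) * (1 + fps_const w * fps_X)"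
  have "fps_const w * fps_const w = - fps_const b"
    using w2 by simp
  then have q: "q = 1 + fps_const 0 * fps_X + fps_const (a * 0 + b) * fps_X ^ 2"
    unfolding q_def by (simp add: algebra_simps power2_eq_square)
  have eq: "inverse ((1 + fps_X) * q ^ Suc k) =
      pole_pair w (Suc k) (Suc k) * inverse ((1 - fps_const (- 1) * fps_X) ^ 1)" for k
    by (simp add: q_def pole_pair_def power_mult_distrib fps_inverse_mult ac_simps flip: fps_const_neg)
  have asymp: "osc_asymp w (0 + k) (1 / (fact k * 2 ^ Suc k) / (1 + 1 / w))
      (1 / (fact k * 2 ^ Suc k) / (1 - 1 / w)) (inverse ((1 + fps_X) * q ^ Suc k))" for k
    unfolding eq
    by (rule osc_asymp_cong[OF osc_asymp_linear_power_div[OF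
          osc_asymp_pole_pair[of w "Suc k" "0 + k" "Suc k"], of "- 1" 1]])
      (use w in auto)
  define s where "s = 1 / w"
  define B where "B = 1 / (1 + s)"
  define C where "C = 1 / (1 - s)"
  have "0 < s" "s < 1"
    using w by (simp_all add: s_def)
  then have "B > 0" "C > 0" "s > 0"
    by (simp_all add: B_def C_def)
  have "(B / 2 + C / 2) * (2 * (s\<^sup>2 * ((1 + a * s)\<^sup>2 * (B / 16)) + s\<^sup>2 * ((1 - a * s)\<^sup>2 * (C / 16))))
      \<le> (s * ((1 + a * s) * (B / 4)) - s * ((1 - a * s) * (C / 4)))\<^sup>2"
    using real_rooted_even_limits[OF gen real q _ asymp] w
    by (simp add: numeral_2_eq_2 B_def C_def s_def)
  moreover have "(B / 2 + C / 2) * (2 * (s\<^sup>2 * ((1 + a * s)\<^sup>2 * (B / 16)) + s\<^sup>2 * ((1 - a * s)\<^sup>2 * (C / 16))))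
      - (s * ((1 + a * s) * (B / 4)) - s * ((1 - a * s) * (C / 4)))\<^sup>2 = s\<^sup>2 * B * C / 4"
    by (simp add: field_simps power2_eq_square)
  moreover have "s\<^sup>2 * B * C > 0"
    using \<open>B > 0\<close> \<open>C > 0\<close> \<open>s > 0\<close> by simp
  ultimately show False
    by linarith
qed

text \<open>The remaining pair \<open>a = 1\<close>, \<open>b = -1\<close> is exceptional because there \<open>a z + b = z - 1\<close> makes the
  quadratic \<open>(1 - t\<^sup>2) + z t (1 + t)\<close> divisible by \<open>1 + t\<close>: the pole at \<open>-1\<close> does not move with \<open>z\<close>.\<close>

lemma not_real_rooted:
  assumes gen: "generated_by a b P" and b: "b < 1 + 2 * \<bar>a\<bar>"
  shows "\<exists>n. \<not> zeros (P n) \<subseteq> \<real>"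
proof -
  consider "b < - 1" | "b = - 1" "a \<noteq> 1" | "b = - 1" "a = 1" | "- 1 < b" "a \<ge> 0" | "- 1 < b" "a < 0"
    by linarith
  then show ?thesis
  proof cases
    case 3
    obtain H :: "nat \<Rightarrow> real poly" where H: "H 0 = 1" "H 1 = - [:0, 1:]"
      "\<And>n. H (n + 2) = - [:0, 1:] * H (n + 1) - [:b, a:] * H n"
      and P: "P 0 = 1" "\<And>n. P (Suc n) = H (Suc n) - P n"
      using generated_by_recurrence[OF gen] by blast
    have "P 2 = H (0 + 2) - (H 1 - P 0)"
      using P(2)[of 1] P(2)[of 0] by (simp add: numeral_2_eq_2)
    also have "\<dots> = [:2, 0, 1:]"
      unfolding H(3) using 3 H(1,2) P(1) by (simp add: one_pCons)
    finally have P2: "P 2 = [:2, 0, 1:]" .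
    have "\<not> zeros (P 2) \<subseteq> \<real>"
      using laguerre_inequality[of "P 2" 0] by (auto simp: P2 pderiv_pCons)
    then show ?thesis ..
  qed (use assms in \<open>auto intro: not_real_rooted_opposite_poles not_real_rooted_three_unit_poles
      not_real_rooted_pole_at_1 not_real_rooted_pole_at_minus_1\<close>)
qed

section \<open>The characterisation\<close>

theorem theorem1:
  fixes a b :: real and P :: "nat \<Rightarrow> real poly"
  assumes "generated_by a b P"
  shows "((\<forall>n. zeros (P n) \<subseteq> \<real>) \<longleftrightarrow> b \<ge> 1 + 2 * \<bar>a\<bar>) \<and>
    (b \<ge> 1 + 2 * \<bar>a\<bar> \<longrightarrow>
      (\<forall>n. zeros (P n) \<subseteq> complex_of_real ` zero_interval a b) \<and>
      (\<forall>u v. u < v \<and> {u<..<v} \<subseteq> zero_interval a b \<longrightarrow>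
        (\<forall>\<^sub>F n in sequentially. \<exists>x\<in>{u<..<v}. complex_of_real x \<in> zeros (P n))))"
proof (intro conjI impI iffI allI)
  show "b \<ge> 1 + 2 * \<bar>a\<bar>" if "\<forall>n. zeros (P n) \<subseteq> \<real>"
    using that not_real_rooted[OF assms] by (meson not_le)
next
  fix n assume b: "b \<ge> 1 + 2 * \<bar>a\<bar>"
  show "zeros (P n) \<subseteq> complex_of_real ` zero_interval a b"
    using assms b by (rule zeros_subset_zero_interval)
  then show "zeros (P n) \<subseteq> \<real>"
    by (auto simp: Reals_def)
next
  fix u v assume "b \<ge> 1 + 2 * \<bar>a\<bar>" "u < v \<and> {u<..<v} \<subseteq> zero_interval a b"
  then show "\<forall>\<^sub>F n in sequentially. \<exists>x\<in>{u<..<v}. complex_of_real x \<in> zeros (P n)"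
    using eventually_zero_in_subinterval[OF assms] by blast
qed

end
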